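(* For all $\tau\in\mathbb{H}$, $$u^2(\tau)-u(2\tau)+2u(\tau)u^2(2\tau)=0.$$
   Context: $\mathbb{H}$ is the complex upper half-plane, $q=e^{2\pi i\tau}$ and $q^r=e^{2\pi i r\tau}$ for rational $r$, $\eta(\tau)=q^{1/24}\prod_{n=1}^\infty(1-q^n)$ is the Dedekind eta function, and $$u(\tau):=\dfrac{\eta(3\tau)\eta^3(18\tau)}{\eta(6\tau)\eta^3(9\tau)}.$$ Here $u^k(\tau)$ denotes $u(\tau)^k$. *)

theory Defs
  imports "HOL-Analysis.Analysis"
begin

text \<open>
  The power \<open>q\<^sup>r\<close> for rational \<open>r\<close>, where \<open>q = exp (2 \<pi> \<i> \<tau>)\<close>. It is a function of \<open>\<tau>\<close>
  rather than of \<open>q\<close>, so that no branch of the logarithm is involved.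
\<close>
definition q_pow :: "rat \<Rightarrow> complex \<Rightarrow> complex" where
  "q_pow r \<tau> = exp (2 * of_real pi * \<i> * of_rat r * \<tau>)"

text \<open>
  The product index is shifted by one: the library's \<open>\<Prod>n\<close> starts at \<open>n = 0\<close>.
  The definition is meaningful only for \<open>Im \<tau> > 0\<close>.
\<close>
definition dedekind_eta :: "complex \<Rightarrow> complex" where
  "dedekind_eta \<tau> = q_pow (1/24) \<tau> * (\<Prod>n. 1 - q_pow 1 \<tau> ^ Suc n)"

definition u :: "complex \<Rightarrow> complex" where
  "u \<tau> = (dedekind_eta (3 * \<tau>) * dedekind_eta (18 * \<tau>) ^ 3) /
         (dedekind_eta (6 * \<tau>) * dedekind_eta (9 * \<tau>) ^ 3)"

end

theory Submission
  imports Defs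
begin

text \<open>
  Put \<open>x = exp (2 \<pi> \<i> \<tau>)\<close>. The powers of \<open>exp (2 \<pi> \<i> \<tau> / 24)\<close> in front of the four eta products
  combine to exactly \<open>x\<close>, and \<open>u \<tau>\<close> is Ramanujan's cubic continued fraction \<open>v(x)\<close>
  (\<open>cubic_cf\<close> below) in the variable \<open>q\<^sup>1\<^sup>/\<^sup>3 = x\<close>. Since \<open>\<tau> \<mapsto> 2 \<tau>\<close> is \<open>x \<mapsto> x\<^sup>2\<close>, the claim is the
  degree 2 modular equation \<open>v\<^sup>2 - w + 2 v w\<^sup>2 = 0\<close> between \<open>v = v(x)\<close> and \<open>w = v(x\<^sup>2)\<close>.

  The trick is to bring in the third value \<open>v' = v(-x)\<close> and to determine its product and its sum
  with \<open>v\<close>. The product representation of \<open>v\<close> gives \<open>v v' = - w\<close> at once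
  (\<open>cubic_cf_mult_minus\<close>). For the sum, let \<open>\<theta>(x) = \<Sum>j\<in>\<int>. (-1)^j x^(j^2)\<close>. Splitting this series
  according to \<open>j\<close> mod 3 and rewriting each part as a product yields
  \<open>\<theta>(x) = (1 - 2 v(x)) \<theta>(x\<^sup>9)\<close> (\<open>theta_dissection\<close>), while the product for \<open>\<theta>\<close> yields
  \<open>\<theta>(x) \<theta>(-x) = \<theta>(x\<^sup>2)\<^sup>2\<close> (\<open>theta_mult_minus\<close>). Dividing the latter by the same identity at
  \<open>x\<^sup>9\<close> gives \<open>(1 - 2 v) (1 - 2 v') = (1 - 2 w)\<^sup>2\<close>. Together with \<open>v v' = - w\<close> this says
  \<open>v + v' = - 2 w\<^sup>2\<close>; multiplying by \<open>v\<close> and using \<open>v v' = - w\<close> once more proves the claim.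

  The products for \<open>\<theta>\<close> and for the parts of its series come from the Jacobi triple product identity
  (\<open>jacobi_triple_product\<close>), obtained as the limit of the finite identity that the \<open>q\<close>-binomial theorem provides.
\<close>

section \<open>Infinite \<open>q\<close>-Pochhammer symbols\<close>

definition qpoch :: "complex \<Rightarrow> complex \<Rightarrow> complex" where
  "qpoch a p = (\<Prod>n. 1 - a * p ^ n)"

lemma convergent_prod_qpoch:
  assumes "norm p < 1"
  shows "convergent_prod (\<lambda>n. 1 - a * p ^ n :: complex)"
proof -
  have "summable (\<lambda>n. norm a * norm p ^ n)"
    using assms by (intro summable_mult summable_geometric) auto
  hence "abs_convergent_prod (\<lambda>n. 1 - a * p ^ n)"
    by (simp add: abs_convergent_prod_conv_summable norm_mult norm_power)
  thus ?thesis by (rule abs_convergent_prod_imp_convergent_prod)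
qed

lemma qpoch_LIMSEQ:
  assumes "norm p < 1"
  shows "(\<lambda>n. \<Prod>k<n. 1 - a * p ^ k) \<longlonglongrightarrow> qpoch a p"
  unfolding qpoch_def
  by (intro has_prod_imp_tendsto' convergent_prod_has_prod convergent_prod_qpoch assms)

lemma qpoch_nonzero:
  assumes "norm p < 1" "norm a < 1"
  shows "qpoch a p \<noteq> 0"
  unfolding qpoch_def
proof (rule prodinf_nonzero)
  show "convergent_prod (\<lambda>n. 1 - a * p ^ n)" by (rule convergent_prod_qpoch) fact
  show "1 - a * p ^ n \<noteq> 0" for n
  proof
    assume "1 - a * p ^ n = 0"
    hence "norm (a * p ^ n) = 1" by simp
    moreover have "norm (a * p ^ n) \<le> norm a * 1"
      unfolding norm_mult norm_power using assms
      by (intro mult_left_mono power_le_one) auto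
    ultimately show False using assms by simp
  qed
qed

lemma qpoch_mult_minus:
  assumes "norm p < 1"
  shows "qpoch a p * qpoch (-a) p = qpoch (a\<^sup>2) (p\<^sup>2)"
proof -
  have "qpoch a p * qpoch (-a) p = (\<Prod>n. (1 - a * p ^ n) * (1 - (-a) * p ^ n))"
    unfolding qpoch_def by (intro prodinf_mult convergent_prod_qpoch assms)
  also have "\<dots> = qpoch (a\<^sup>2) (p\<^sup>2)"
    unfolding qpoch_def
    by (intro prodinf_cong) (simp add: algebra_simps power2_eq_square power_mult_distrib)
  finally show ?thesis .
qed

text \<open>
  Grouping the exponents by their residue mod \<open>m\<close>. The partial products of length \<open>n m\<close> agree, so
  no rearrangement of infinite products is involved.
\<close>
lemma qpoch_multisection:
  assumes "norm p < 1" "m > 0"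
  shows "qpoch a p = (\<Prod>i<m. qpoch (a * p ^ i) (p ^ m))"
proof (rule LIMSEQ_unique)
  have pm: "norm (p ^ m) < 1"
    using assms by (simp add: norm_power power_less_one_iff)
  show "(\<lambda>n. \<Prod>k<n*m. 1 - a * p ^ k) \<longlonglongrightarrow> qpoch a p"
    using LIMSEQ_subseq_LIMSEQ[OF qpoch_LIMSEQ[OF assms(1)], of "\<lambda>n. n * m"] assms(2)
    by (auto simp: strict_mono_def o_def)
  have "(\<Prod>k<n*m. 1 - a * p ^ k) = (\<Prod>i<m. \<Prod>k<n. 1 - a * p ^ i * (p ^ m) ^ k)" for n
  proof -
    have "(\<Prod>k<n*m. 1 - a * p ^ k) = (\<Prod>k<n. \<Prod>j\<in>{k*m..<k*m+m}. 1 - a * p ^ j)"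
      by (simp add: prod.nat_group)
    also have "\<dots> = (\<Prod>k<n. \<Prod>i<m. 1 - a * p ^ (i + k * m))"
      using prod.shift_bounds_nat_ivl[of "\<lambda>j. 1 - a * p ^ j" 0 _ m]
      by (simp add: prod.atLeastLessThan_shift_0[of _ "_ * m"] lessThan_atLeast0 add.commute)
    also have "\<dots> = (\<Prod>i<m. \<Prod>k<n. 1 - a * p ^ (i + k * m))"
      by (rule prod.swap)
    finally show ?thesis
      by (simp add: power_add power_mult [symmetric] mult.commute mult.assoc mult.left_commute)
  qed
  thus "(\<lambda>n. \<Prod>k<n*m. 1 - a * p ^ k) \<longlonglongrightarrow> (\<Prod>i<m. qpoch (a * p ^ i) (p ^ m))"
    by (simp only:) (intro tendsto_prod qpoch_LIMSEQ pm)
qed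

section \<open>Gaussian binomial coefficients\<close>

text \<open>
  Defining the coefficients by the \<open>q\<close>-Pascal rule makes them vanish for \<open>k > n\<close>, so that
  the induction behind the \<open>q\<close>-binomial theorem has no boundary cases.
\<close>
fun qbinomial :: "'a::idom \<Rightarrow> nat \<Rightarrow> nat \<Rightarrow> 'a" where
  "qbinomial p n 0 = 1"
| "qbinomial p 0 (Suc k) = 0"
| "qbinomial p (Suc n) (Suc k) = qbinomial p n k + p ^ Suc k * qbinomial p n (Suc k)"

lemma qbinomial_eq_0: "n < k \<Longrightarrow> qbinomial p n k = 0"
  by (induction p n k rule: qbinomial.induct) auto

text \<open>
  The usual quotient of \<open>q\<close>-factorials, stated without division so that it also holds when \<open>p\<close> is
  a root of unity. It is what gives access to the limit of the coefficients.
\<close>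
lemma qbinomial_mult_factorials:
  assumes "k \<le> n"
  shows "qbinomial p n k * ((\<Prod>i<k. 1 - p ^ Suc i) * (\<Prod>i<n-k. 1 - p ^ Suc i)) = (\<Prod>i<n. 1 - p ^ Suc i)"
  using assms
proof (induction p n k rule: qbinomial.induct)
  case (3 p n k)
  define P where "P m = (\<Prod>i<m. 1 - p ^ Suc i)" for m
  have P_Suc: "P (Suc m) = P m * (1 - p ^ Suc m)" for m
    by (simp add: P_def)
  have IH1: "qbinomial p n k * (P k * P (n - k)) = P n"
    using 3 by (simp add: P_def)
  have "p ^ Suc k * (qbinomial p n (Suc k) * (P (Suc k) * P (n - k))) = (p ^ Suc k - p ^ Suc n) * P n"
  proof (cases "k = n")
    case True
    thus ?thesis by (simp add: qbinomial_eq_0)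
  next
    case False
    with 3 have k: "n - k = Suc (n - Suc k)" "Suc k \<le> n" by auto
    have IH2: "qbinomial p n (Suc k) * (P (Suc k) * P (n - Suc k)) = P n"
      using 3 k(2) by (simp add: P_def)
    have pn: "p ^ Suc k * p ^ (n - k) = p ^ Suc n"
      using k(2) by (simp add: mult.assoc flip: power_add)
    have "P (n - k) = P (n - Suc k) * (1 - p ^ (n - k))"
      unfolding k(1) by (rule P_Suc)
    hence "p ^ Suc k * (qbinomial p n (Suc k) * (P (Suc k) * P (n - k))) =
        (p ^ Suc k - p ^ Suc k * p ^ (n - k)) * (qbinomial p n (Suc k) * (P (Suc k) * P (n - Suc k)))"
      by (simp only: ring_distribs mult_ac mult_1_left mult_1_right)
    thus ?thesis unfolding IH2 pn .
  qed
  note IH2 = this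
  have "qbinomial p (Suc n) (Suc k) * (P (Suc k) * P (n - k)) =
      (1 - p ^ Suc k) * (qbinomial p n k * (P k * P (n - k))) +
      p ^ Suc k * (qbinomial p n (Suc k) * (P (Suc k) * P (n - k)))"
    by (simp only: qbinomial.simps P_Suc[of k] algebra_simps mult_1_left mult_1_right)
  also have "\<dots> = P (Suc n)"
    unfolding IH1 IH2 P_Suc[of n] by (simp only: ring_distribs mult_ac mult_1_left) simp
  finally have "qbinomial p (Suc n) (Suc k) * (P (Suc k) * P (n - k)) = P (Suc n)" .
  thus ?case by (simp only: P_def diff_Suc_Suc)
qed auto

text \<open>
  The \<open>q\<close>-binomial theorem with base \<open>q\<^sup>2\<close> and odd exponents, which turns the usual exponent
  \<open>k (k - 1)\<close> into \<open>k\<^sup>2\<close>. In the induction step the factor for \<open>k = 0\<close> is split off; the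
  others form the product for \<open>n\<close> at \<open>y q\<^sup>2\<close>.
\<close>
lemma qbinomial_theorem:
  fixes q y :: "'a :: idom"
  shows "(\<Prod>k<n. 1 + y * q ^ (2*k+1)) = (\<Sum>k\<le>n. qbinomial (q\<^sup>2) n k * q ^ k\<^sup>2 * y ^ k)"
proof (induction n arbitrary: y)
  case (Suc n)
  define c where "c n k = qbinomial (q\<^sup>2) n k * q ^ k\<^sup>2" for n k
  have c_Suc: "c (Suc n) (Suc k) = q ^ (2*k+1) * c n k + q ^ (2*k+2) * c n (Suc k)" for k
  proof -
    have "q ^ (Suc k)\<^sup>2 = q ^ k\<^sup>2 * q ^ (2*k+1)"
      by (simp add: power2_eq_square algebra_simps mult_2_right flip: power_add)
    moreover have "(q\<^sup>2) ^ Suc k = q ^ (2*k+2)"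
      by (metis add_2_eq_Suc' mult_Suc_right add.commute power_mult)
    ultimately show ?thesis
      by (simp only: c_def qbinomial.simps ring_distribs mult_ac)
  qed
  have scale: "(y * q\<^sup>2) ^ k = q ^ (2*k) * y ^ k" for k
    by (simp add: power_mult_distrib mult.commute flip: power_mult)
  have "(\<Prod>k<Suc n. 1 + y * q ^ (2*k+1)) = (1 + y * q) * (\<Prod>k<n. 1 + (y * q\<^sup>2) * q ^ (2*k+1))"
    by (simp add: prod.lessThan_Suc_shift power2_eq_square algebra_simps del: prod.lessThan_Suc)
  also have "(\<Prod>k<n. 1 + (y * q\<^sup>2) * q ^ (2*k+1)) = (\<Sum>k\<le>n. c n k * (y * q\<^sup>2) ^ k)"
    by (simp only: Suc.IH c_def)
  also have "(1 + y * q) * \<dots> = (\<Sum>k\<le>n. q ^ (2*k+1) * c n k * y ^ Suc k) + (\<Sum>k\<le>Suc n. c n k * (y * q\<^sup>2) ^ k)"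
    unfolding scale
    by (simp add: c_def qbinomial_eq_0 sum_distrib_left algebra_simps flip: sum.distrib)
  also have "(\<Sum>k\<le>Suc n. c n k * (y * q\<^sup>2) ^ k) = 1 + (\<Sum>k\<le>n. q ^ (2*k+2) * c n (Suc k) * y ^ Suc k)"
    unfolding scale by (subst sum.atMost_Suc_shift) (simp add: c_def algebra_simps)
  also have "(\<Sum>k\<le>n. q ^ (2*k+1) * c n k * y ^ Suc k) + \<dots> = 1 + (\<Sum>k\<le>n. c (Suc n) (Suc k) * y ^ Suc k)"
    unfolding c_Suc by (simp add: algebra_simps sum.distrib)
  also have "\<dots> = (\<Sum>k\<le>Suc n. c (Suc n) k * y ^ k)"
    by (subst sum.atMost_Suc_shift) (simp add: c_def)
  finally show ?case by (simp only: c_def)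
qed auto

section \<open>The Jacobi triple product\<close>

text \<open>
  The \<open>q\<close>-binomial theorem for \<open>2 n\<close> factors at \<open>y = z / q\<^sup>2\<^sup>n\<close>: the exponents of \<open>q\<close> then run
  symmetrically through \<open>-(2 n - 1), \<dots>, -1, 1, \<dots>, 2 n - 1\<close>. Pulling \<open>z / q\<^sup>2\<^sup>k\<^sup>+\<^sup>1\<close> out of
  the factors with negative exponent produces \<open>z^n / q^(n^2)\<close>, the same factor by which completing
  the square \<open>k\<^sup>2 - 2 n k = (k - n)\<^sup>2 - n\<^sup>2\<close> changes the sum.
\<close>
lemma finite_triple_product:
  fixes q z :: complex
  assumes "q \<noteq> 0" "z \<noteq> 0"
  shows "(\<Prod>k<n. 1 + z * q ^ (2*k+1)) * (\<Prod>k<n. 1 + q ^ (2*k+1) / z) =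
         (\<Sum>j\<in>{-int n..int n}. qbinomial (q\<^sup>2) (2*n) (nat (int n + j)) * (z powi j * q powi j\<^sup>2))"
proof -
  define y where "y = z / q ^ (2*n)"
  define e where "e = z ^ n / q ^ n\<^sup>2"
  have e: "e \<noteq> 0" using assms by (simp add: e_def)
  have odd: "(\<Prod>k<n. q ^ (2*k+1)) = q ^ n\<^sup>2" for n
    by (induction n) (simp_all add: power2_eq_square algebra_simps mult_2_right flip: power_add)
  have "(\<Prod>k<2*n. 1 + y * q ^ (2*k+1)) =
        (\<Prod>k<n. 1 + y * q ^ (2*k+1)) * (\<Prod>k\<in>{n..<2*n}. 1 + y * q ^ (2*k+1))"
    by (subst prod.union_disjoint [symmetric]) (auto intro!: prod.cong)
  also have "(\<Prod>k\<in>{n..<2*n}. 1 + y * q ^ (2*k+1)) = (\<Prod>k<n. 1 + z * q ^ (2*k+1))"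
  proof (rule prod.reindex_bij_witness[of _ "\<lambda>k. k + n" "\<lambda>k. k - n"])
    fix k assume "k \<in> {n..<2*n}"
    hence "2*k+1 = 2*n + (2*(k-n)+1)" by auto
    hence "q ^ (2*k+1) = q ^ (2*n) * q ^ (2*(k-n)+1)"
      by (metis power_add)
    thus "1 + z * q ^ (2*(k-n)+1) = 1 + y * q ^ (2*k+1)"
      using assms by (simp add: y_def)
  qed auto
  also have "(\<Prod>k<n. 1 + y * q ^ (2*k+1)) = (\<Prod>k<n. z / q ^ (2*k+1) * (1 + q ^ (2*k+1) / z))"
  proof (rule prod.reindex_bij_witness[of _ "\<lambda>k. n - 1 - k" "\<lambda>k. n - 1 - k"])
    fix k assume "k \<in> {..<n}"
    hence "2*n = (2*k+1) + (2*(n-1-k)+1)" by auto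
    hence "q ^ (2*n) = q ^ (2*k+1) * q ^ (2*(n-1-k)+1)"
      by (metis power_add)
    thus "z / q ^ (2*(n-1-k)+1) * (1 + q ^ (2*(n-1-k)+1) / z) = 1 + y * q ^ (2*k+1)"
      using assms by (simp add: y_def field_simps)
  qed auto
  also have "\<dots> = e * (\<Prod>k<n. 1 + q ^ (2*k+1) / z)"
    unfolding prod.distrib prod_dividef odd by (simp add: e_def)
  finally have lhs: "(\<Prod>k<2*n. 1 + y * q ^ (2*k+1)) =
      e * ((\<Prod>k<n. 1 + z * q ^ (2*k+1)) * (\<Prod>k<n. 1 + q ^ (2*k+1) / z))"
    by (simp add: mult_ac)
  have "(\<Sum>k\<le>2*n. qbinomial (q\<^sup>2) (2*n) k * q ^ k\<^sup>2 * y ^ k) =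
        (\<Sum>j\<in>{-int n..int n}. e * (qbinomial (q\<^sup>2) (2*n) (nat (int n + j)) * (z powi j * q powi j\<^sup>2)))"
  proof (rule sum.reindex_bij_witness[of _ "\<lambda>j. nat (int n + j)" "\<lambda>k. int k - int n"])
    fix k assume "k \<in> {..2*n}"
    have "q powi (int k - int n)\<^sup>2 = q powi (int (k\<^sup>2) + int (n\<^sup>2) - int (2*n*k))"
      by (simp add: power2_eq_square algebra_simps)
    also have "\<dots> = q ^ k\<^sup>2 * q ^ n\<^sup>2 / q ^ (2*n*k)"
      using assms
      by (subst power_int_diff, simp, subst power_int_add, simp) (simp only: power_int_of_nat)
    finally show "e * (qbinomial (q\<^sup>2) (2*n) (nat (int n + (int k - int n))) *
           (z powi (int k - int n) * q powi (int k - int n)\<^sup>2)) = qbinomial (q\<^sup>2) (2*n) k * q ^ k\<^sup>2 * y ^ k"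
      using assms by (simp add: e_def y_def power_int_diff power_divide flip: power_mult)
  qed auto
  with lhs show ?thesis
    unfolding qbinomial_theorem sum_distrib_left [symmetric] using e by simp
qed

text \<open>The terms are \<open>(w r\<^sup>k)\<^sup>k\<close>, and \<open>w r\<^sup>k\<close> is eventually at most \<open>1/2\<close>.\<close>
lemma summable_theta_nat:
  fixes r w :: real
  assumes "0 \<le> r" "r < 1" "0 \<le> w"
  shows "summable (\<lambda>k. w ^ k * r ^ k\<^sup>2)"
proof (rule summable_comparison_test_ev)
  have "(\<lambda>k. w * r ^ k) \<longlonglongrightarrow> w * 0"
    using assms by (intro tendsto_mult tendsto_const LIMSEQ_power_zero) auto
  hence "\<forall>\<^sub>F k in sequentially. w * r ^ k < 1/2"
    by (rule order_tendstoD) auto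
  thus "\<forall>\<^sub>F k in sequentially. norm (w ^ k * r ^ k\<^sup>2) \<le> (1/2) ^ k"
  proof eventually_elim
    case (elim k)
    have "norm (w ^ k * r ^ k\<^sup>2) = (w * r ^ k) ^ k"
      using assms by (simp add: power_mult_distrib power2_eq_square abs_mult power_mult)
    also have "\<dots> \<le> (1/2) ^ k"
      using elim assms by (intro power_mono) auto
    finally show ?case .
  qed
  show "summable (\<lambda>k. (1/2::real) ^ k)" by (rule summable_geometric) auto
qed

lemma summable_on_theta:
  fixes r w :: real
  assumes "0 \<le> r" "r < 1" "0 \<le> w"
  shows "(\<lambda>j::int. w powi j * r powi j\<^sup>2) summable_on UNIV"
proof -
  have half: "(\<lambda>k. v ^ k * r ^ k\<^sup>2) summable_on UNIV" if "0 \<le> v" for v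
    using that assms by (intro summable_nonneg_imp_summable_on summable_theta_nat) auto
  have sq: "r powi (int k)\<^sup>2 = r ^ k\<^sup>2" for k
    using power_int_of_nat[of r "k\<^sup>2"] by simp
  have "(\<lambda>j. w powi j * r powi j\<^sup>2) summable_on range int"
    using half[of w] assms by (subst summable_on_reindex) (auto simp: o_def sq)
  moreover have "(\<lambda>j. w powi j * r powi j\<^sup>2) summable_on range (\<lambda>k. - int k)"
    using half[of "inverse w"] assms
    by (subst summable_on_reindex) (auto simp: o_def sq inj_def power_int_minus power_inverse)
  ultimately have "(\<lambda>j. w powi j * r powi j\<^sup>2) summable_on (range int \<union> range (\<lambda>k. - int k))"
    by (rule summable_on_union)
  moreover have "j \<in> range int \<union> range (\<lambda>k. - int k)" for j
    by (cases j rule: int_cases2) auto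
  hence "range int \<union> range (\<lambda>k. - int k) = UNIV" by blast
  ultimately show ?thesis by (simp only:)
qed

text \<open>
  Tannery's theorem for series over the integers, obtained from the one for sequences by
  enumerating the integers. The sums that converge to \<open>S\<close> are finite; the conclusion that the limit
  series sums to \<open>S\<close> unconditionally is what later permits splitting it by residue classes.
\<close>
lemma tannery_int:
  fixes a :: "nat \<Rightarrow> int \<Rightarrow> 'a :: {real_normed_algebra, banach}"
  assumes lim: "\<And>j. (\<lambda>n. a n j) \<longlonglongrightarrow> b j"
    and bound: "\<And>n j. norm (a n j) \<le> M j" and M: "M summable_on UNIV"
    and supp: "\<And>n j. j \<notin> {-int n..int n} \<Longrightarrow> a n j = 0"
    and S: "(\<lambda>n. \<Sum>j\<in>{-int n..int n}. a n j) \<longlonglongrightarrow> S"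
  shows "(b has_sum S) UNIV"
proof -
  have bij: "bij_betw int_decode UNIV UNIV"
    by (rule bij_int_decode)
  have "(\<lambda>k. M (int_decode k)) summable_on UNIV"
    using M summable_on_reindex_bij_betw[OF bij] by blast
  hence "summable (\<lambda>k. M (int_decode k))"
    by (rule summable_on_imp_summable)
  moreover have "\<forall>\<^sub>F (k, n) in sequentially \<times>\<^sub>F sequentially. norm (a n (int_decode k)) \<le> M (int_decode k)"
    using bound by (simp add: case_prod_unfold)
  ultimately have b: "summable (\<lambda>k. norm (b (int_decode k)))"
    and conv: "(\<lambda>n. \<Sum>k. a n (int_decode k)) \<longlonglongrightarrow> (\<Sum>k. b (int_decode k))"
    using tannerys_theorem[of "\<lambda>k n. a n (int_decode k)" "\<lambda>k. b (int_decode k)" sequentially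
        "\<lambda>k. M (int_decode k)"] lim by simp_all
  have "(\<Sum>k. a n (int_decode k)) = (\<Sum>j\<in>{-int n..int n}. a n j)" for n
  proof -
    have "(a n has_sum (\<Sum>j\<in>{-int n..int n}. a n j)) UNIV"
      using supp by (intro has_sum_finite_neutralI) auto
    hence "((\<lambda>k. a n (int_decode k)) has_sum (\<Sum>j\<in>{-int n..int n}. a n j)) UNIV"
      by (subst has_sum_reindex_bij_betw[OF bij])
    thus ?thesis by (simp add: has_sum_imp_sums sums_unique [symmetric])
  qed
  with conv S have "(\<Sum>k. b (int_decode k)) = S"
    by (simp add: LIMSEQ_unique)
  hence "(\<lambda>k. b (int_decode k)) sums S"
    using summable_norm_cancel[OF b] by (simp add: sums_iff)
  with b have "((\<lambda>k. b (int_decode k)) has_sum S) UNIV"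
    by (rule norm_summable_imp_has_sum)
  thus ?thesis by (subst (asm) has_sum_reindex_bij_betw[OF bij])
qed

text \<open>
  The central coefficients are \<open>P(2 n) / (P(n + j) P(n - j))\<close>, where the partial products
  \<open>P(m)\<close> converge to the nonzero number \<open>qpoch p p\<close>. So they tend to its inverse, and since \<open>P\<close>
  and \<open>1 / P\<close> are bounded, all Gaussian binomials to base \<open>p\<close> are bounded by one constant. The
  truncation to \<open>\<bar>j\<bar> \<le> n\<close> keeps \<open>nat\<close> from collapsing negative lower indices to \<open>0\<close>.
\<close>
lemma central_qbinomial:
  assumes "norm p < 1"
  shows "(\<lambda>n. if j \<in> {-int n..int n} then qbinomial p (2*n) (nat (int n + j)) else 0)
           \<longlonglongrightarrow> inverse (qpoch p p)"
    and "\<exists>C. \<forall>n k. norm (qbinomial p n k) \<le> C"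
proof -
  define P where "P m = (\<Prod>i<m. 1 - p ^ Suc i)" for m
  have P: "P \<longlonglongrightarrow> qpoch p p"
    using qpoch_LIMSEQ[OF assms, of p] by (simp add: P_def [abs_def])
  have nz: "qpoch p p \<noteq> 0"
    using assms by (intro qpoch_nonzero)
  have P_nz: "P m \<noteq> 0" for m
  proof -
    have "p ^ Suc i \<noteq> 1" for i
    proof
      assume "p ^ Suc i = 1"
      hence "norm p ^ Suc i = 1" by (metis norm_one norm_power)
      moreover have "norm p ^ Suc i < 1"
        using assms by (simp add: power_less_one_iff del: power_Suc)
      ultimately show False by simp
    qed
    thus ?thesis by (simp add: P_def)
  qed
  have quot: "qbinomial p n k = P n * (inverse (P k) * inverse (P (n - k)))" if "k \<le> n" for n k
  proof -
    have "qbinomial p n k * (P k * P (n - k)) = P n"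
      using qbinomial_mult_factorials[OF that, of p] by (simp add: P_def)
    thus ?thesis using P_nz by (simp add: field_simps)
  qed
  have lim_shift: "(\<lambda>n. P (nat (int n + i))) \<longlonglongrightarrow> qpoch p p" for i
  proof (rule filterlim_compose[OF P])
    show "filterlim (\<lambda>n. nat (int n + i)) sequentially sequentially"
      unfolding filterlim_at_top
    proof
      fix Z
      show "\<forall>\<^sub>F n in sequentially. Z \<le> nat (int n + i)"
        using eventually_ge_at_top[of "nat (int Z - i)"] by eventually_elim linarith
    qed
  qed
  have "(\<lambda>n. P (2*n) * (inverse (P (nat (int n + j))) * inverse (P (nat (int n + (-j))))))
          \<longlonglongrightarrow> qpoch p p * (inverse (qpoch p p) * inverse (qpoch p p))"
    using LIMSEQ_subseq_LIMSEQ[OF P, of "\<lambda>n. 2 * n"] nz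
    by (intro tendsto_intros lim_shift) (auto simp: strict_mono_def o_def)
  also have "qpoch p p * (inverse (qpoch p p) * inverse (qpoch p p)) = inverse (qpoch p p)"
    using nz by simp
  finally show "(\<lambda>n. if j \<in> {-int n..int n} then qbinomial p (2*n) (nat (int n + j)) else 0)
           \<longlonglongrightarrow> inverse (qpoch p p)"
  proof (rule Lim_transform_eventually)
    show "\<forall>\<^sub>F n in sequentially.
            P (2*n) * (inverse (P (nat (int n + j))) * inverse (P (nat (int n + (-j))))) =
            (if j \<in> {-int n..int n} then qbinomial p (2*n) (nat (int n + j)) else 0)"
      using eventually_ge_at_top[of "nat \<bar>j\<bar>"]
    proof eventually_elim
      case (elim n)
      hence j: "j \<in> {-int n..int n}" and le: "nat (int n + j) \<le> 2 * n"
        and eq: "2 * n - nat (int n + j) = nat (int n + (-j))" by auto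
      show ?case unfolding quot[OF le] eq using j by simp
    qed
  qed
  have "Bseq P" "Bseq (\<lambda>n. inverse (P n))"
    using P tendsto_inverse[OF P nz] by (auto intro!: convergent_imp_Bseq simp: convergent_def)
  then obtain A B where A: "\<And>n. norm (P n) \<le> A" and B: "\<And>n. norm (inverse (P n)) \<le> B"
    unfolding Bseq_def by blast
  have [simp]: "0 \<le> A" "0 \<le> B" using A[of 0] B[of 0] norm_ge_zero order_trans by blast+
  have "norm (qbinomial p n k) \<le> A * (B * B)" for n k
  proof (cases "k \<le> n")
    case True
    show ?thesis unfolding quot[OF True] norm_mult
      by (intro mult_mono A B) auto
  qed (auto simp: qbinomial_eq_0)
  thus "\<exists>C. \<forall>n k. norm (qbinomial p n k) \<le> C" by blast
qed

text \<open>
  Let \<open>n\<close> tend to infinity in \<open>finite_triple_product\<close>: the coefficients tend to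
  \<open>1 / qpoch (q\<^sup>2) (q\<^sup>2)\<close>, whence the third factor of the product.
\<close>
theorem jacobi_triple_product:
  fixes q z :: complex
  assumes q: "q \<noteq> 0" "norm q < 1" and z: "z \<noteq> 0"
  shows "((\<lambda>j. z powi j * q powi j\<^sup>2) has_sum
           qpoch (q\<^sup>2) (q\<^sup>2) * qpoch (- z * q) (q\<^sup>2) * qpoch (- q / z) (q\<^sup>2)) UNIV"
proof -
  define t where "t j = z powi j * q powi j\<^sup>2" for j
  define B where "B n j = (if j \<in> {-int n..int n} then qbinomial (q\<^sup>2) (2*n) (nat (int n + j)) else 0)" for n j
  have q2: "norm (q\<^sup>2) < 1"
    using q by (simp add: norm_power power_less_one_iff)
  obtain C where C: "\<And>n k. norm (qbinomial (q\<^sup>2) n k) \<le> C"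
    using central_qbinomial(2)[OF q2] by blast
  have [simp]: "0 \<le> C" using C[of 0 0] norm_ge_zero order_trans by blast
  have "((\<lambda>j. inverse (qpoch (q\<^sup>2) (q\<^sup>2)) * t j) has_sum (qpoch (- z * q) (q\<^sup>2) * qpoch (- q / z) (q\<^sup>2))) UNIV"
  proof (rule tannery_int)
    show "(\<lambda>n. B n j * t j) \<longlonglongrightarrow> inverse (qpoch (q\<^sup>2) (q\<^sup>2)) * t j" for j
      unfolding B_def by (intro tendsto_intros central_qbinomial q2)
    show "norm (B n j * t j) \<le> C * (norm z powi j * norm q powi j\<^sup>2)" for n j
      using C by (auto simp: B_def t_def norm_mult norm_power_int intro!: mult_right_mono)
    show "(\<lambda>j. C * (norm z powi j * norm q powi j\<^sup>2)) summable_on UNIV"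
      using q by (intro summable_on_cmult_right summable_on_theta) auto
    show "B n j * t j = 0" if "j \<notin> {-int n..int n}" for n j
      unfolding B_def using that by (simp only: if_False mult_zero_left)
    have "(\<Sum>j\<in>{-int n..int n}. B n j * t j) =
          (\<Prod>k<n. 1 - (- z * q) * (q\<^sup>2) ^ k) * (\<Prod>k<n. 1 - (- q / z) * (q\<^sup>2) ^ k)" for n
      using finite_triple_product[OF q(1) z, of n]
      by (simp add: B_def t_def power_mult mult.assoc)
    thus "(\<lambda>n. \<Sum>j\<in>{-int n..int n}. B n j * t j)
            \<longlonglongrightarrow> qpoch (- z * q) (q\<^sup>2) * qpoch (- q / z) (q\<^sup>2)"
      by (simp only:) (intro tendsto_mult qpoch_LIMSEQ q2)
  qed
  hence "((\<lambda>j. qpoch (q\<^sup>2) (q\<^sup>2) * (inverse (qpoch (q\<^sup>2) (q\<^sup>2)) * t j)) has_sum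
      qpoch (q\<^sup>2) (q\<^sup>2) * (qpoch (- z * q) (q\<^sup>2) * qpoch (- q / z) (q\<^sup>2))) UNIV"
    by (rule has_sum_cmult_right)
  moreover have "qpoch (q\<^sup>2) (q\<^sup>2) * (inverse (qpoch (q\<^sup>2) (q\<^sup>2)) * t j) = t j" for j
    using qpoch_nonzero[OF q2 q2] by (simp add: mult.assoc [symmetric])
  ultimately show ?thesis by (simp only: t_def mult.assoc)
qed

section \<open>The theta function\<close>

lemma qpoch_even_odd:
  assumes "norm y < 1"
  shows "qpoch y y = qpoch y (y\<^sup>2) * qpoch (y\<^sup>2) (y\<^sup>2)"
  using qpoch_multisection[OF assms, of 2 y] by (simp add: numeral_2_eq_2)

text \<open>
  The classical \<open>\<phi>(-x) = \<Sum>j\<in>\<int>. (-1)^j x^(j^2)\<close>, defined by its product because that form shows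
  that it has no zeros in the unit disc.
\<close>
definition theta :: "complex \<Rightarrow> complex" where
  "theta x = qpoch (x\<^sup>2) (x\<^sup>2) * qpoch x (x\<^sup>2) ^ 2"

lemma theta_nonzero:
  assumes "norm x < 1"
  shows "theta x \<noteq> 0"
proof -
  have "norm (x\<^sup>2) < 1" using assms by (simp add: norm_power power_less_one_iff)
  thus ?thesis using assms by (simp add: theta_def qpoch_nonzero)
qed

lemma has_sum_theta:
  assumes "x \<noteq> 0" "norm x < 1"
  shows "((\<lambda>j. (-1) powi j * x powi j\<^sup>2) has_sum theta x) UNIV"
  using jacobi_triple_product[of x "-1"] assms
  by (simp add: theta_def power2_eq_square mult.assoc)

lemma theta_mult_minus:
  assumes "norm x < 1"
  shows "theta x * theta (-x) = theta (x\<^sup>2) ^ 2"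
proof -
  have x2: "norm (x\<^sup>2) < 1" using assms by (simp add: norm_power power_less_one_iff)
  have "qpoch x (x\<^sup>2) * qpoch (-x) (x\<^sup>2) = qpoch (x\<^sup>2) (x ^ 4)"
    using qpoch_mult_minus[OF x2, of x] by (simp flip: power_mult)
  moreover have "qpoch (x\<^sup>2) (x\<^sup>2) = qpoch (x\<^sup>2) (x ^ 4) * qpoch (x ^ 4) (x ^ 4)"
    using qpoch_even_odd[OF x2] by (simp flip: power_mult)
  moreover have "theta (x\<^sup>2) = qpoch (x ^ 4) (x ^ 4) * qpoch (x\<^sup>2) (x ^ 4) ^ 2"
    by (simp add: theta_def flip: power_mult)
  moreover have "theta x * theta (-x) = (qpoch (x\<^sup>2) (x\<^sup>2) * (qpoch x (x\<^sup>2) * qpoch (-x) (x\<^sup>2)))\<^sup>2"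
    by (simp add: theta_def power2_eq_square mult_ac)
  ultimately show ?thesis
    by (simp add: power2_eq_square mult_ac)
qed

section \<open>Ramanujan's cubic continued fraction\<close>

text \<open>
  Ramanujan's \<open>q\<^sup>1\<^sup>/\<^sup>3 (q; q\<^sup>2) / (q\<^sup>3; q\<^sup>6)\<^sup>3\<close> in the variable \<open>x = q\<^sup>1\<^sup>/\<^sup>3\<close>. With \<open>x\<close> as the
  variable no branch of the cube root has to be chosen, and \<open>x \<mapsto> - x\<close> makes sense.
\<close>
definition cubic_cf :: "complex \<Rightarrow> complex" where
  "cubic_cf x = x * qpoch (x ^ 3) (x ^ 6) / qpoch (x ^ 9) (x ^ 18) ^ 3"

text \<open>
  In the series of \<open>theta x\<close> the indices \<open>3 k\<close> contribute \<open>theta (x ^ 9)\<close>. The indices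
  \<open>3 k + 1\<close> and \<open>-(3 k + 1)\<close> cover the other two residue classes and have equal terms, because
  only \<open>j\<^sup>2\<close> and the parity of \<open>j\<close> matter. As \<open>(3 k + 1)\<^sup>2 = 9 k\<^sup>2 + 6 k + 1\<close>, each
  contributes \<open>- x\<close> times a triple product with \<open>q = x\<^sup>9\<close> and \<open>z = - x\<^sup>6\<close>, and the quotient of
  that product by \<open>theta (x ^ 9)\<close> is \<open>cubic_cf x / x\<close>.
\<close>
lemma theta_dissection:
  assumes x: "x \<noteq> 0" "norm x < 1"
  shows "theta x = (1 - 2 * cubic_cf x) * theta (x ^ 9)"
proof -
  define T where "T = qpoch (x ^ 18) (x ^ 18) * qpoch (x ^ 15) (x ^ 18) * qpoch (x ^ 3) (x ^ 18)"
  define t where "t j = (-1) powi j * x powi j\<^sup>2" for j :: int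
  have small: "norm (x ^ k) < 1" if "k > 0" for k
    using x that by (simp add: norm_power power_less_one_iff)
  have sgn3: "(-1::complex) powi (3 * k) = (-1) powi k" for k
    by (simp add: power_int_minus_left)
  have "((\<lambda>k. t (3 * k)) has_sum theta (x ^ 9)) UNIV"
  proof -
    have "t (3 * k) = (-1) powi k * (x ^ 9) powi k\<^sup>2" for k
      by (simp add: t_def sgn3 power_mult_distrib power_int_mult)
    with has_sum_theta[of "x ^ 9"] small x show ?thesis by simp
  qed
  hence h0: "(t has_sum theta (x ^ 9)) (range (\<lambda>k. 3 * k))"
    by (subst has_sum_reindex) (auto simp: inj_def o_def)
  have t_shift: "(-x) * ((- (x ^ 6)) powi k * (x ^ 9) powi k\<^sup>2) = t (3 * k + 1)" for k
  proof -
    have "t (3 * k + 1) = (-1) powi (3 * k + 1) * x powi (1 + 6 * k + 9 * k\<^sup>2)"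
      unfolding t_def by (simp add: power2_eq_square algebra_simps)
    also have "\<dots> = - ((-1) powi k) * (x * (x ^ 6) powi k * (x ^ 9) powi k\<^sup>2)"
      using x by (simp add: power_int_add sgn3 power_int_mult)
    also have "\<dots> = (-x) * ((- (x ^ 6)) powi k * (x ^ 9) powi k\<^sup>2)"
      using power_int_mult_distrib[of "-1" "x ^ 6" k] by simp
    finally show ?thesis ..
  qed
  have "((\<lambda>k. (- (x ^ 6)) powi k * (x ^ 9) powi k\<^sup>2) has_sum T) UNIV"
  proof -
    have "x ^ 9 / x ^ 6 = x ^ 3" using x by (simp add: field_simps flip: power_add)
    with jacobi_triple_product[of "x ^ 9" "- (x ^ 6)"] small[of 9] x show ?thesis
      by (simp add: T_def flip: power_mult power_add)
  qed
  hence h: "((\<lambda>k. t (3 * k + 1)) has_sum (-x) * T) UNIV"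
    unfolding t_shift [symmetric] by (rule has_sum_cmult_right)
  hence h1: "(t has_sum (-x) * T) (range (\<lambda>k. 3 * k + 1))"
    by (subst has_sum_reindex) (auto simp: inj_def o_def)
  have t_minus: "t (- j) = t j" for j
    by (simp add: t_def power_int_minus_left)
  have "((\<lambda>k. t (- (3 * k + 1))) has_sum (-x) * T) UNIV"
    unfolding t_minus by (rule h)
  hence h2: "(t has_sum (-x) * T) (range (\<lambda>k. - (3 * k + 1)))"
    by (subst has_sum_reindex) (auto simp: inj_def o_def)
  have "range (\<lambda>k. 3 * k) \<union> range (\<lambda>k. 3 * k + 1) \<union> range (\<lambda>k. - (3 * k + 1)) = (UNIV :: int set)"
  proof -
    have "j \<in> range (\<lambda>k. 3 * k) \<union> range (\<lambda>k. 3 * k + 1) \<union> range (\<lambda>k. - (3 * k + 1))" for j :: int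
    proof -
      have "j = 3 * (j div 3) \<or> j = 3 * (j div 3) + 1 \<or> j = - (3 * (- (j div 3) - 1) + 1)"
        by presburger
      thus ?thesis by blast
    qed
    thus ?thesis by blast
  qed
  moreover have "(t has_sum (theta (x ^ 9) + (-x) * T + (-x) * T))
      (range (\<lambda>k. 3 * k) \<union> range (\<lambda>k. 3 * k + 1) \<union> range (\<lambda>k. - (3 * k + 1)))"
  proof (intro has_sum_Un_disjoint h0 h1 h2)
    show "range (\<lambda>k. 3 * k) \<inter> range (\<lambda>k. 3 * k + 1) = ({} :: int set)"
      by auto presburger
    show "(range (\<lambda>k. 3 * k) \<union> range (\<lambda>k. 3 * k + 1)) \<inter> range (\<lambda>k. - (3 * k + 1)) = ({} :: int set)"
      by auto presburger+
  qed
  ultimately have "(t has_sum (theta (x ^ 9) + (-x) * T + (-x) * T)) UNIV" by simp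
  moreover have "(t has_sum theta x) UNIV"
    unfolding t_def by (rule has_sum_theta[OF x])
  ultimately have "theta (x ^ 9) + (-x) * T + (-x) * T = theta x"
    by (rule has_sum_unique)
  hence dis: "theta x = theta (x ^ 9) - 2 * (x * T)"
    by (simp add: algebra_simps)
  have "qpoch (x ^ 3) (x ^ 6) = qpoch (x ^ 3) (x ^ 18) * qpoch (x ^ 9) (x ^ 18) * qpoch (x ^ 15) (x ^ 18)"
    using qpoch_multisection[of "x ^ 6" 3 "x ^ 3"] small[of 6]
    by (simp add: lessThan_nat_numeral power_add [symmetric] power_mult [symmetric] mult_ac)
  moreover have "theta (x ^ 9) = qpoch (x ^ 18) (x ^ 18) * qpoch (x ^ 9) (x ^ 18) ^ 2"
    by (simp add: theta_def flip: power_mult)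
  moreover have "qpoch (x ^ 9) (x ^ 18) \<noteq> 0"
    by (intro qpoch_nonzero small) auto
  ultimately have "cubic_cf x * theta (x ^ 9) = x * T"
    by (simp add: cubic_cf_def T_def field_simps eval_nat_numeral)
  with dis show ?thesis by (simp only: left_diff_distrib mult.assoc mult_1_left)
qed

lemma cubic_cf_mult_minus:
  assumes "norm x < 1"
  shows "cubic_cf x * cubic_cf (-x) = - cubic_cf (x\<^sup>2)"
proof -
  have small: "norm (x ^ k) < 1" if "k > 0" for k
    using assms that by (simp add: norm_power power_less_one_iff)
  have "qpoch (x ^ 3) (x ^ 6) * qpoch (- (x ^ 3)) (x ^ 6) = qpoch (x ^ 6) (x ^ 12)"
       "qpoch (x ^ 9) (x ^ 18) * qpoch (- (x ^ 9)) (x ^ 18) = qpoch (x ^ 18) (x ^ 36)"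
    using qpoch_mult_minus[OF small[of 6], of "x ^ 3"] qpoch_mult_minus[OF small[of 18], of "x ^ 9"]
    by (simp_all flip: power_mult)
  note prods = this
  have "cubic_cf x * cubic_cf (-x) =
      - (x\<^sup>2 * (qpoch (x ^ 3) (x ^ 6) * qpoch (- (x ^ 3)) (x ^ 6)) /
         (qpoch (x ^ 9) (x ^ 18) * qpoch (- (x ^ 9)) (x ^ 18)) ^ 3)"
    by (simp add: cubic_cf_def power2_eq_square power_mult_distrib)
  also have "\<dots> = - cubic_cf (x\<^sup>2)"
    unfolding prods by (simp add: cubic_cf_def flip: power_mult)
  finally show ?thesis .
qed

text \<open>
  Inserting \<open>theta_dissection\<close> at \<open>x\<close>, \<open>-x\<close> and \<open>x\<^sup>2\<close> into \<open>theta_mult_minus\<close> leaves theta values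
  at \<open>x\<^sup>9\<close>, \<open>-x\<^sup>9\<close> and \<open>x\<^sup>1\<^sup>8\<close>, which cancel by \<open>theta_mult_minus\<close> at \<open>x\<^sup>9\<close>. The remaining
  polynomial relation between \<open>v\<close>, \<open>v'\<close> and \<open>w\<close> becomes linear in \<open>v + v'\<close> through \<open>v v' = - w\<close>.
\<close>
theorem cubic_cf_degree_2:
  assumes x: "x \<noteq> 0" "norm x < 1"
  shows "cubic_cf x ^ 2 - cubic_cf (x\<^sup>2) + 2 * cubic_cf x * cubic_cf (x\<^sup>2) ^ 2 = 0"
proof -
  have small: "norm (x ^ k) < 1" if "k > 0" for k
    using assms that by (simp add: norm_power power_less_one_iff)
  define v v' w where "v = cubic_cf x" and "v' = cubic_cf (-x)" and "w = cubic_cf (x\<^sup>2)"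
  define c where "c = theta (x ^ 18)"
  have "c \<noteq> 0" unfolding c_def by (intro theta_nonzero small) auto
  have vv': "v * v' = - w"
    using cubic_cf_mult_minus[OF x(2)] by (simp add: v_def v'_def w_def)
  have "theta x = (1 - 2 * v) * theta (x ^ 9)" "theta (-x) = (1 - 2 * v') * theta (- (x ^ 9))"
       "theta (x\<^sup>2) = (1 - 2 * w) * c"
    using theta_dissection[OF x] theta_dissection[of "-x"] theta_dissection[of "x\<^sup>2"] x small[of 2]
    by (simp_all add: v_def v'_def w_def c_def flip: power_mult)
  moreover have "theta (x ^ 9) * theta (- (x ^ 9)) = c\<^sup>2"
    using theta_mult_minus[of "x ^ 9"] small[of 9] by (simp add: c_def flip: power_mult)
  ultimately have "(1 - 2 * v) * (1 - 2 * v') * c\<^sup>2 = (1 - 2 * w)\<^sup>2 * c\<^sup>2"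
    using theta_mult_minus[OF x(2)] by algebra
  with \<open>c \<noteq> 0\<close> have "(1 - 2 * v) * (1 - 2 * v') = (1 - 2 * w)\<^sup>2"
    by simp
  with vv' have "2 * (v + v' + 2 * w\<^sup>2) = 0" by algebra
  hence "v + v' + 2 * w\<^sup>2 = 0" by (simp only: mult_eq_0_iff) simp
  \<comment> \<open>Multiply by \<open>v\<close>, which turns \<open>v'\<close> into \<open>- w\<close>.\<close>
  with vv' have "v\<^sup>2 - w + 2 * v * w\<^sup>2 = 0" by algebra
  thus ?thesis by (simp add: v_def w_def)
qed

section \<open>The eta quotient\<close>

lemma q_pow_power: "q_pow r \<tau> ^ k = q_pow (of_nat k * r) \<tau>"
  by (simp add: q_pow_def of_rat_mult exp_of_nat_mult [symmetric] algebra_simps)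

lemma q_pow_of_nat_mult: "q_pow r (of_nat k * \<tau>) = q_pow (of_nat k * r) \<tau>"
  by (simp add: q_pow_def of_rat_mult algebra_simps)

lemma dedekind_eta_mult_nat:
  "dedekind_eta (of_nat k * \<tau>) = q_pow (of_nat k / 24) \<tau> * qpoch (q_pow 1 \<tau> ^ k) (q_pow 1 \<tau> ^ k)"
  by (simp add: dedekind_eta_def qpoch_def q_pow_of_nat_mult q_pow_power)

text \<open>
  The exponents of \<open>s = exp (2 \<pi> \<i> \<tau> / 24)\<close> add up to \<open>3 + 3 \<cdot> 18 - 6 - 3 \<cdot> 9 = 24\<close>, and the
  Euler products at even multiples of \<open>\<tau>\<close> cancel the even parts of those at odd multiples.
\<close>
lemma u_eq_cubic_cf:
  assumes "Im \<tau> > 0"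
  shows "u \<tau> = cubic_cf (q_pow 1 \<tau>)" and "norm (q_pow 1 \<tau>) < 1"
proof -
  define x where "x = q_pow 1 \<tau>"
  define s where "s = q_pow (1/24) \<tau>"
  have s: "s \<noteq> 0" and sx: "s ^ 24 = x"
    using q_pow_power[of "1/24" \<tau> 24] by (simp_all add: s_def x_def q_pow_def)
  have x: "norm x < 1"
    using assms by (simp add: x_def q_pow_def)
  thus "norm (q_pow 1 \<tau>) < 1" by (simp add: x_def)
  have small: "norm (x ^ k) < 1" if "k > 0" for k
    using x that by (simp add: norm_power power_less_one_iff)
  have nz: "qpoch (x ^ a) (x ^ b) \<noteq> 0" if "a > 0" "b > 0" for a b
    by (intro qpoch_nonzero small that)
  have eta: "dedekind_eta (of_nat k * \<tau>) = s ^ k * qpoch (x ^ k) (x ^ k)" for k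
    using q_pow_power[of "1/24" \<tau> k] by (simp add: dedekind_eta_mult_nat s_def x_def)
  have split: "qpoch (x ^ 3) (x ^ 3) = qpoch (x ^ 3) (x ^ 6) * qpoch (x ^ 6) (x ^ 6)"
              "qpoch (x ^ 9) (x ^ 9) = qpoch (x ^ 9) (x ^ 18) * qpoch (x ^ 18) (x ^ 18)"
    using qpoch_even_odd[OF small[of 3]] qpoch_even_odd[OF small[of 9]] by (simp_all flip: power_mult)
  have "s ^ 3 * (s ^ 18) ^ 3 = s ^ 24 * (s ^ 6 * (s ^ 9) ^ 3)"
    by (simp flip: power_add power_mult)
  hence "u \<tau> = s ^ 24 * qpoch (x ^ 3) (x ^ 6) / qpoch (x ^ 9) (x ^ 18) ^ 3"
    using eta[of 3] eta[of 18] eta[of 6] eta[of 9] s nz[of 6 6] nz[of 18 18] nz[of 9 18]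
    by (simp add: u_def split power_mult_distrib divide_simps)
  thus "u \<tau> = cubic_cf (q_pow 1 \<tau>)" by (simp add: sx cubic_cf_def flip: x_def)
qed

theorem theorem4p4:
  fixes \<tau> :: complex
  assumes "Im \<tau> > 0"
  shows "u \<tau> ^ 2 - u (2 * \<tau>) + 2 * u \<tau> * u (2 * \<tau>) ^ 2 = 0"
proof -
  have "u (2 * \<tau>) = cubic_cf (q_pow 1 (2 * \<tau>))"
    using assms by (intro u_eq_cubic_cf) simp
  also have "q_pow 1 (2 * \<tau>) = (q_pow 1 \<tau>)\<^sup>2"
    using q_pow_of_nat_mult[of 1 2 \<tau>] q_pow_power[of 1 \<tau> 2] by simp
  finally show ?thesis
    using cubic_cf_degree_2[of "q_pow 1 \<tau>"] u_eq_cubic_cf[OF assms]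
    by (simp add: q_pow_def)
qed

end
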